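(* For every $\varepsilon > 0$ there exists a quasi-metric space $(Z,\rho)$ such that: (i) for every triple of points $z_0, z_1, z_2 \in Z$, $$\rho(z_1,z_2) \le (1+\varepsilon)\,[\rho(z_1,z_0)+\rho(z_0,z_2)];$$ (ii) the chain approach applied to $\rho$ does not lead to a metric space, i.e. the function $d: Z\times Z\to[0,\infty)$ defined by $$d(z,z')=\inf \sum_{i=0}^{n}\rho(z_i,z_{i+1}),$$ where the infimum is taken over all finite sequences $z=z_0,z_1,\dots,z_{n+1}=z'$ in $Z$ (with $n\ge 0$ arbitrary), is not a metric on $Z$.
   Context: A quasi-metric space is a set $Z$ with a function $\rho: Z\times Z\to[0,\infty)$ (called a quasi-metric) satisfying: (1) $\rho(z,z')\ge 0$ for all $z,z'\in Z$, and $\rho(z,z')=0$ if and only if $z=z'$; (2) $\rho(z,z')=\rho(z',z)$ for all $z,z'\in Z$; (3) there is a fixed constant $K\ge 1$ such that $\rho(z,z'')\le K\max\{\rho(z,z'),\rho(z',z'')\}$ for all $z,z',z''\in Z$. For any quasi-metric $\rho$, the function $d$ in the claim is symmetric, nonnegative and satisfies the triangle inequality, so $d$ fails to be a metric exactly when $d(z,z')=0$ for some pair of distinct points $z\neq z'$. *)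

theory Defs
  imports "HOL-Analysis.Analysis"
begin

definition quasi_metric_on :: "'a set \<Rightarrow> ('a \<Rightarrow> 'a \<Rightarrow> real) \<Rightarrow> bool" where
  "quasi_metric_on Z \<rho> \<longleftrightarrow>
     (\<forall>z\<in>Z. \<forall>z'\<in>Z. 0 \<le> \<rho> z z' \<and> (\<rho> z z' = 0 \<longleftrightarrow> z = z')) \<and>
     (\<forall>z\<in>Z. \<forall>z'\<in>Z. \<rho> z z' = \<rho> z' z) \<and>
     (\<exists>K\<ge>1. \<forall>z\<in>Z. \<forall>z'\<in>Z. \<forall>z''\<in>Z. \<rho> z z'' \<le> K * max (\<rho> z z') (\<rho> z' z''))"

definition chain_sums :: "'a set \<Rightarrow> ('a \<Rightarrow> 'a \<Rightarrow> real) \<Rightarrow> 'a \<Rightarrow> 'a \<Rightarrow> real set" where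
  "chain_sums Z \<rho> z z' =
     {(\<Sum>i\<le>n. \<rho> (s i) (s (Suc i))) | (n::nat) (s::nat \<Rightarrow> 'a).
        (\<forall>i\<le>Suc n. s i \<in> Z) \<and> s 0 = z \<and> s (Suc n) = z'}"

text \<open>The library's \<^locale>\<open>Metric_space\<close> demands symmetry and nonnegativity on the whole
  type, not only on the carrier. The value 0 outside \<open>Z\<close> makes these demands vacuous there, as
  the lemma below confirms.\<close>

definition chain_dist :: "'a set \<Rightarrow> ('a \<Rightarrow> 'a \<Rightarrow> real) \<Rightarrow> 'a \<Rightarrow> 'a \<Rightarrow> real" where
  "chain_dist Z \<rho> z z' = (if z \<in> Z \<and> z' \<in> Z then Inf (chain_sums Z \<rho> z z') else 0)"

lemma Metric_space_chain_dist_iff: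
  "Metric_space Z (chain_dist Z \<rho>) \<longleftrightarrow>
     (\<forall>x\<in>Z. \<forall>y\<in>Z. 0 \<le> chain_dist Z \<rho> x y \<and> (chain_dist Z \<rho> x y = 0 \<longleftrightarrow> x = y)) \<and>
     (\<forall>x\<in>Z. \<forall>y\<in>Z. chain_dist Z \<rho> x y = chain_dist Z \<rho> y x) \<and>
     (\<forall>x\<in>Z. \<forall>y\<in>Z. \<forall>z\<in>Z. chain_dist Z \<rho> x z \<le> chain_dist Z \<rho> x y + chain_dist Z \<rho> y z)"
  (is "?L \<longleftrightarrow> ?R")
proof
  assume ?L
  then interpret Metric_space Z "chain_dist Z \<rho>" .
  show ?R using commute triangle by auto
next
  have off: "chain_dist Z \<rho> x y = 0" if "\<not> (x \<in> Z \<and> y \<in> Z)" for x y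
    using that unfolding chain_dist_def by (rule if_not_P)
  assume R: ?R
  show ?L
  proof
    show "0 \<le> chain_dist Z \<rho> x y" for x y
      using R off[of x y] by (cases "x \<in> Z \<and> y \<in> Z") auto
    show "chain_dist Z \<rho> x y = chain_dist Z \<rho> y x" for x y
      using R off[of x y] off[of y x] by (cases "x \<in> Z \<and> y \<in> Z") auto
  qed (use R in blast)+
qed

end

theory Submission
  imports Defs
begin

text \<open>Take \<open>\<rho> x y = \<bar>x - y\<bar> powr p\<close> on the real line, with \<open>p > 1\<close> close to 1. Convexity of
  \<open>t powr p\<close> gives the relaxed triangle inequality with constant \<open>2 powr (p - 1)\<close>, while cutting
  \<open>[0, 1]\<close> into \<open>n\<close> equal steps gives a chain of total length \<open>n powr (1 - p)\<close>, which tends to 0.\<close>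

lemma powr_add_le:
  fixes a b p :: real
  assumes "1 \<le> p" "0 \<le> a" "0 \<le> b"
  shows "(a + b) powr p \<le> 2 powr (p - 1) * (a powr p + b powr p)"
\<comment> \<open>Convexity is applied only to strictly positive arguments. If one of them vanishes,
  \<open>1 \<le> 2 powr (p - 1)\<close> suffices.\<close>
proof (cases "a = 0 \<or> b = 0")
  case True
  have "1 * t powr p \<le> 2 powr (p - 1) * t powr p" for t :: real
    using assms by (intro mult_right_mono) (auto simp: ge_one_powr_ge_zero)
  with True assms show ?thesis
    by auto
next
  case False
  \<comment> \<open>Convexity at the midpoint; multiplying by \<open>2 powr p\<close> then leaves
    the factor \<open>2 powr p / 2 = 2 powr (p - 1)\<close>.\<close>
  have "((1 - 1/2) *\<^sub>R a + (1/2) *\<^sub>R b) powr p \<le> (1 - 1/2) * a powr p + (1/2) * b powr p"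
    using False assms by (intro convex_onD[OF powr_convex]) auto
  then have "((a + b) / 2) powr p \<le> (a powr p + b powr p) / 2"
    by (simp add: add_divide_distrib)
  then show ?thesis
    using assms by (simp add: powr_divide powr_diff field_simps)
qed

text \<open>Nonnegativity of \<open>\<rho>\<close> makes 0 a lower bound of all chain sums, so their
  \<open>Inf\<close> is a genuine infimum and lies below each of them.\<close>

lemma chain_dist_le:
  assumes "\<And>z z'. z \<in> Z \<Longrightarrow> z' \<in> Z \<Longrightarrow> 0 \<le> \<rho> z z'"
    and "\<And>i. i \<le> Suc n \<Longrightarrow> s i \<in> Z"
  shows "chain_dist Z \<rho> (s 0) (s (Suc n)) \<le> (\<Sum>i\<le>n. \<rho> (s i) (s (Suc i)))"
proof -
  have "bdd_below (chain_sums Z \<rho> (s 0) (s (Suc n)))"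
    unfolding chain_sums_def
    by (rule bdd_belowI[of _ 0]) (auto intro!: sum_nonneg assms(1))
  moreover have "(\<Sum>i\<le>n. \<rho> (s i) (s (Suc i))) \<in> chain_sums Z \<rho> (s 0) (s (Suc n))"
    using assms(2) unfolding chain_sums_def by blast
  ultimately show ?thesis
    using assms(2) by (simp add: chain_dist_def cInf_lower)
qed

lemma chain_dist_powr_le:
  fixes p :: real
  shows "chain_dist UNIV (\<lambda>x y. \<bar>x - y\<bar> powr p) 0 1 \<le> real (Suc n) powr (1 - p)"
proof -
  \<comment> \<open>The sum over \<open>i \<le> n\<close> has \<open>Suc n\<close> terms, hence
    steps of length \<open>1 / Suc n\<close>.\<close>
  define s where "s i = real i / real (Suc n)" for i
  have step: "\<bar>s i - s (Suc i)\<bar> powr p = real (Suc n) powr (- p)" for i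
  proof -
    have "s i - s (Suc i) = - (1 / real (Suc n))"
      unfolding s_def diff_divide_distrib[symmetric] by simp
    then show ?thesis
      by (simp add: powr_divide powr_minus_divide)
  qed
  have "chain_dist UNIV (\<lambda>x y. \<bar>x - y\<bar> powr p) (s 0) (s (Suc n))
      \<le> (\<Sum>i\<le>n. \<bar>s i - s (Suc i)\<bar> powr p)"
    by (rule chain_dist_le) auto
  also have "\<dots> = real (Suc n) * real (Suc n) powr (- p)"
    by (simp only: step) simp
  also have "\<dots> = real (Suc n) powr (1 - p)"
    by (simp add: powr_diff powr_minus_divide)
  finally show ?thesis
    by (simp add: s_def)
qed

theorem mainTheorem1:
  fixes \<epsilon> :: real
  assumes "\<epsilon> > 0"
  shows "\<exists>(Z :: real set) (\<rho> :: real \<Rightarrow> real \<Rightarrow> real).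
    quasi_metric_on Z \<rho> \<and>
    (\<forall>z0\<in>Z. \<forall>z1\<in>Z. \<forall>z2\<in>Z. \<rho> z1 z2 \<le> (1 + \<epsilon>) * (\<rho> z1 z0 + \<rho> z0 z2)) \<and>
    \<not> Metric_space Z (chain_dist Z \<rho>)"
proof -
  \<comment> \<open>Solves \<open>2 powr (p - 1) = 1 + \<epsilon>\<close>; the logarithm is positive
    because \<open>\<epsilon> > 0\<close>, so \<open>p > 1\<close>.\<close>
  define p where "p = 1 + log 2 (1 + \<epsilon>)"
  define \<rho> :: "real \<Rightarrow> real \<Rightarrow> real" where "\<rho> x y = \<bar>x - y\<bar> powr p" for x y
  have p: "p > 1" "2 powr (p - 1) = 1 + \<epsilon>"
    using assms by (auto simp: p_def)
  have tri: "\<rho> x z \<le> (1 + \<epsilon>) * (\<rho> x y + \<rho> y z)" for x y z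
  proof -
    have "\<rho> x z \<le> (\<bar>x - y\<bar> + \<bar>y - z\<bar>) powr p"
      unfolding \<rho>_def using p by (intro powr_mono2) auto
    also have "\<dots> \<le> (1 + \<epsilon>) * (\<rho> x y + \<rho> y z)"
      unfolding \<rho>_def p(2)[symmetric] using p by (intro powr_add_le) auto
    finally show ?thesis .
  qed
  \<comment> \<open>A sum is at most twice the maximum, so \<open>K = 2 * (1 + \<epsilon>)\<close>
    serves as the quasi-metric constant.\<close>
  have "\<rho> x z \<le> 2 * (1 + \<epsilon>) * max (\<rho> x y) (\<rho> y z)" for x y z
  proof -
    have "(1 + \<epsilon>) * (\<rho> x y + \<rho> y z) \<le> (1 + \<epsilon>) * (2 * max (\<rho> x y) (\<rho> y z))"
      using assms by (intro mult_left_mono) auto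
    with tri[of x z y] show ?thesis
      by (simp add: algebra_simps)
  qed
  moreover have "1 \<le> 2 * (1 + \<epsilon>)"
    using assms by simp
  ultimately have "\<exists>K\<ge>1. \<forall>x y z. \<rho> x z \<le> K * max (\<rho> x y) (\<rho> y z)"
    by blast
  then have quasi: "quasi_metric_on UNIV \<rho>"
    unfolding quasi_metric_on_def by (auto simp: \<rho>_def abs_minus_commute)
  \<comment> \<open>The exponent \<open>1 - p\<close> is negative, so the bounds on the chain
    distance from 0 to 1 vanish in the limit, whereas a metric would separate these points.\<close>
  have "(\<lambda>n. real (Suc n) powr (1 - p)) \<longlonglongrightarrow> 0"
    using p by (intro tendsto_neg_powr filterlim_compose[OF filterlim_real_sequentially filterlim_Suc]) auto
  then have "chain_dist UNIV \<rho> 0 1 \<le> 0"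
    by (rule LIMSEQ_le_const) (use chain_dist_powr_le in \<open>auto simp: \<rho>_def [abs_def]\<close>)
  then have "\<not> Metric_space UNIV (chain_dist UNIV \<rho>)"
    by (metis Metric_space.mdist_pos_less UNIV_I not_less zero_neq_one)
  with quasi tri show ?thesis
    by blast
qed

end
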